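(* The $(4,5)$-spectrum is the set of all integers greater than or equal to $19$, that is, $\{19,20,21,\dots\}$, and $N(4,5)=n(4,5)=19$.
   Context: Graphs are finite and simple. For integers $k\ge 3$, $g\ge 3$, a $(k,g)$-graph is a $k$-regular graph of girth exactly $g$. The $(k,g)$-spectrum is the set of all integers $n$ such that there exists a connected $(k,g)$-graph of order $n$. $n(k,g)$ denotes the smallest order of a $(k,g)$-graph. For even $k$, $N(k,g)$ denotes the smallest integer $N$ such that all integers $n\ge N$ belong to the $(k,g)$-spectrum. *)

theory Defs
  imports "Graph_Theory.Graph_Theory" "HOL-Library.Extended_Nat"
begin

text \<open>
  A finite simple undirected graph is a \<^locale>\<open>pair_graph\<close>: a finite, loop-free digraph with
  symmetric arc set. Each edge \<open>{u, v}\<close> is thus represented by the two arcs \<open>(u, v)\<close> and \<open>(v, u)\<close>,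
  and the degree of a vertex is its out-degree.
\<close>

definition regular :: "nat \<Rightarrow> 'a pair_pre_digraph \<Rightarrow> bool" where
  "regular k G \<longleftrightarrow> (\<forall>v \<in> pverts G. out_degree (with_proj G) v = k)"

text \<open>
  The library's cycles include the closed walks \<open>u, v, u\<close> of length 2 along a single edge. These
  are not cycles of an undirected graph, hence the restriction on the length. The girth of a forest
  is \<open>\<infinity>\<close>, the infimum of the empty set.
\<close>

definition girth :: "'a pair_pre_digraph \<Rightarrow> enat" where
  "girth G = (INF c \<in> {c. pre_digraph.cycle (with_proj G) c \<and> 3 \<le> length c}. enat (length c))"

definition kg_graph :: "nat \<Rightarrow> nat \<Rightarrow> 'a pair_pre_digraph \<Rightarrow> bool" where
  "kg_graph k g G \<longleftrightarrow> pair_graph G \<and> regular k G \<and> girth G = enat g"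

text \<open>
  Vertices are taken from \<^typ>\<open>nat\<close> below. This is no restriction, since every finite graph is
  isomorphic to one with such vertices.
\<close>

definition spectrum :: "nat \<Rightarrow> nat \<Rightarrow> nat set" where
  "spectrum k g =
    {n. \<exists>G :: nat pair_pre_digraph. kg_graph k g G \<and> connected (with_proj G) \<and> card (pverts G) = n}"

definition min_order :: "nat \<Rightarrow> nat \<Rightarrow> nat" where
  "min_order k g = (LEAST n. \<exists>G :: nat pair_pre_digraph. kg_graph k g G \<and> card (pverts G) = n)"

text \<open>The following number is only meaningful for even \<open>k\<close>: a graph of odd degree has even order.\<close>

definition spectrum_threshold :: "nat \<Rightarrow> nat \<Rightarrow> nat" where
  "spectrum_threshold k g = (LEAST N. \<forall>n \<ge> N. n \<in> spectrum k g)"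

end

theory Submission
  imports Defs "HOL-Library.Code_Binary_Nat"
begin

text \<open>
  Lower bound. In a 4-regular graph of girth at least 5 the ball of radius 2 around a vertex is a tree
  with \<open>1 + 4 + 12 = 17\<close> vertices, so the order is at least 17. Orders 17 and 18 are excluded by
  counting the closed walks of length five. Such a walk amounts to a vertex \<open>v\<close> together with an
  arc between two vertices at distance 2 from \<open>v\<close> (\<open>card_closed_5walks\<close>), and with at most one
  vertex outside the ball the number of these arcs is forced
  (\<open>card_closed_5walks_near_Moore\<close>): there would be 612 or 576 closed walks. But rotation
  acts freely on them, so that their number is a multiple of five (\<open>five_dvd_closed_5walks\<close>).

  Existence. Two graphs with a marked Hamiltonian cycle can be welded: cut both Hamiltonian cycles
  open at one edge and reconnect the ends to a single Hamiltonian cycle. This adds the orders, keeps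
  degree 4, and creates no cycle of length less than 5 (\<open>weldable_weld\<close>). Hence it suffices to
  have a graph for each order from 19 to 37, to which copies of the graph of order 19 are welded.
  These graphs are given as unions of two Hamiltonian cycles and checked by evaluation
  (\<open>weldable_if_code\<close>). Connectedness is clear from the Hamiltonian cycle, and a chord from 0
  to 4 provides a 5-cycle.
\<close>

section \<open>Relations without short cycles\<close>

text \<open>
  The first condition excludes loops as well, as closed walks \<open>a, a, a\<close>. The second one has the
  exceptions \<open>a = c\<close> and \<open>b = d\<close> for closed walks that trace a path of length at most 2 back and
  forth.
\<close>

definition no_short_cycle :: "'a rel \<Rightarrow> bool" where
  "no_short_cycle E \<longleftrightarrow>
    (\<forall>a b c. (a, b) \<in> E \<longrightarrow> (b, c) \<in> E \<longrightarrow> (c, a) \<notin> E) \<and>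
    (\<forall>a b c d. (a, b) \<in> E \<longrightarrow> (b, c) \<in> E \<longrightarrow> (c, d) \<in> E \<longrightarrow> (d, a) \<in> E \<longrightarrow> a = c \<or> b = d)"

section \<open>Closed walks of length five\<close>

definition closed_5walks :: "'a rel \<Rightarrow> ('a \<times> 'a \<times> 'a \<times> 'a \<times> 'a) set" where
  "closed_5walks E = {(a, b, c, d, e).
    (a, b) \<in> E \<and> (b, c) \<in> E \<and> (c, d) \<in> E \<and> (d, e) \<in> E \<and> (e, a) \<in> E}"

definition rotations :: "'a \<times> 'a \<times> 'a \<times> 'a \<times> 'a \<Rightarrow> ('a \<times> 'a \<times> 'a \<times> 'a \<times> 'a) set" where
  "rotations = (\<lambda>(a, b, c, d, e).
    {(a, b, c, d, e), (b, c, d, e, a), (c, d, e, a, b), (d, e, a, b, c), (e, a, b, c, d)})"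

lemma rotations_eq: "t \<in> rotations s \<Longrightarrow> rotations t = rotations s"
  by (cases s) (auto simp: rotations_def)

text \<open>
  The cyclic group of order five acts on the closed walks of length five by rotation. As five is
  prime, a walk with a nontrivial stabiliser would be constant, which takes a loop; so every orbit
  has five elements.
\<close>

lemma five_dvd_closed_5walks:
  assumes "finite E" and loopfree: "\<And>v. (v, v) \<notin> E"
  shows "5 dvd card (closed_5walks E)"
proof -
  have sub: "rotations s \<subseteq> closed_5walks E" if "s \<in> closed_5walks E" for s
    using that by (auto simp: closed_5walks_def rotations_def)
  have "s \<in> rotations s" for s :: "'a \<times> 'a \<times> 'a \<times> 'a \<times> 'a"
    by (auto simp: rotations_def)
  then have union: "\<Union> (rotations ` closed_5walks E) = closed_5walks E"
    using sub by blast
  have "closed_5walks E \<subseteq> Field E \<times> Field E \<times> Field E \<times> Field E \<times> Field E"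
    by (auto simp: closed_5walks_def Field_def)
  then have fin: "finite (closed_5walks E)"
    using \<open>finite E\<close> by (auto intro: finite_subset simp: finite_Field)
  have "5 dvd card (\<Union> (rotations ` closed_5walks E))"
  proof (rule dvd_partition)
    show "finite (\<Union> (rotations ` closed_5walks E))"
      using fin by (simp add: union)
    show "\<forall>C\<in>rotations ` closed_5walks E. 5 dvd card C"
    proof (clarsimp, rename_tac a b c d e)
      fix a b c d e assume "(a, b, c, d, e) \<in> closed_5walks E"
      then have "a \<noteq> b"
        using loopfree by (auto simp: closed_5walks_def)
      then have "distinct [(a, b, c, d, e), (b, c, d, e, a), (c, d, e, a, b), (d, e, a, b, c), (e, a, b, c, d)]"
        by fastforce
      from distinct_card[OF this] have "card (rotations (a, b, c, d, e)) = 5"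
        by (simp add: rotations_def)
      then show "5 dvd card (rotations (a, b, c, d, e))"
        by simp
    qed
    show "\<forall>C\<in>rotations ` closed_5walks E. \<forall>D\<in>rotations ` closed_5walks E. C \<noteq> D \<longrightarrow> C \<inter> D = {}"
      using rotations_eq by blast
  qed
  then show ?thesis by (simp add: union)
qed

section \<open>Counting closed walks near the Moore bound\<close>

locale regular_girth_ge5 =
  fixes V :: "'a set" and E :: "'a rel" and k :: nat
  assumes finite_V: "finite V"
    and E_subset: "E \<subseteq> V \<times> V"
    and sym_E: "sym E"
    and degree: "v \<in> V \<Longrightarrow> card (E `` {v}) = k"
    and no_short: "no_short_cycle E"
begin

text \<open>
  For \<open>v \<in> V\<close> these are the vertices at distance exactly 2 and at distance at least 3 from \<open>v\<close>.
\<close>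

definition second :: "'a \<Rightarrow> 'a set" where
  "second v = (\<Union>u\<in>E `` {v}. E `` {u} - {v})"

definition remote :: "'a \<Rightarrow> 'a set" where
  "remote v = V - (insert v (E `` {v} \<union> second v))"

lemma symD': "(u, v) \<in> E \<Longrightarrow> (v, u) \<in> E"
  using sym_E by (rule symD)

lemma triangle_free: "(a, b) \<in> E \<Longrightarrow> (b, c) \<in> E \<Longrightarrow> (c, a) \<in> E \<Longrightarrow> False"
  using no_short unfolding no_short_cycle_def by blast

lemma loop_free: "(v, v) \<notin> E"
  using triangle_free by blast

lemma square_free:
  "(a, b) \<in> E \<Longrightarrow> (b, c) \<in> E \<Longrightarrow> (c, d) \<in> E \<Longrightarrow> (d, a) \<in> E \<Longrightarrow> a = c \<or> b = d"
  using no_short unfolding no_short_cycle_def by blast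

lemma unique_common_neighbour:
  "(a, b) \<in> E \<Longrightarrow> (b, c) \<in> E \<Longrightarrow> (a, d) \<in> E \<Longrightarrow> (d, c) \<in> E \<Longrightarrow> a \<noteq> c \<Longrightarrow> b = d"
  using square_free symD' by blast

lemma finite_neighbours: "finite (E `` {v})"
  using finite_V E_subset by (auto intro: finite_subset)

lemma finite_second: "finite (second v)"
  by (auto simp: second_def finite_neighbours)

lemma second_subset: "second v \<subseteq> V"
  using E_subset by (auto simp: second_def)

lemma levels_disjoint:
  "v \<notin> E `` {v}" "v \<notin> second v" "E `` {v} \<inter> second v = {}"
  by (auto simp: second_def loop_free dest: triangle_free[OF _ _ symD'])

lemma card_second:
  assumes "v \<in> V"
  shows "card (second v) = k * (k - 1)"
proof -
  have "card (second v) = (\<Sum>u\<in>E `` {v}. card (E `` {u} - {v}))"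
    unfolding second_def
    by (rule card_UN_disjoint)
       (auto simp: finite_neighbours intro: unique_common_neighbour)
  also have "\<dots> = (\<Sum>u\<in>E `` {v}. k - 1)"
  proof (rule sum.cong)
    fix u assume u: "u \<in> E `` {v}"
    then have "u \<in> V" "v \<in> E `` {u}"
      using E_subset symD' by auto
    then show "card (E `` {u} - {v}) = k - 1"
      using degree by (simp add: card_Diff_singleton)
  qed simp
  finally show ?thesis
    using degree[OF assms] by simp
qed

text \<open>
  The Moore bound \<open>k\<^sup>2 + 1 \<le> card V\<close>, with the excess identified: the ball of radius 2 is a tree
  with \<open>1 + k + k(k - 1)\<close> vertices.
\<close>

lemma card_levels:
  assumes "v \<in> V"
  shows "card V = k * k + 1 + card (remote v)"
proof -
  have "card (insert v (E `` {v} \<union> second v)) = Suc (k + k * (k - 1))"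
    using levels_disjoint[of v] assms
    by (simp add: card_Un_disjoint finite_neighbours finite_second card_second degree)
  also have "\<dots> = k * k + 1"
    by (cases k) auto
  finally have ball: "card (insert v (E `` {v} \<union> second v)) = k * k + 1" .
  have sub: "insert v (E `` {v} \<union> second v) \<subseteq> V"
    using assms E_subset second_subset by auto
  then have "card (remote v) = card V - (k * k + 1)"
    unfolding remote_def using finite_V ball by (metis card_Diff_subset finite_subset)
  moreover have "k * k + 1 \<le> card V"
    using card_mono[OF finite_V sub] ball by simp
  ultimately show ?thesis by simp
qed

text \<open>
  A vertex at distance 2 from \<open>v\<close> has a single neighbour at distance 1, since a second one would
  close a 4-cycle. Its other neighbours lie at distance 2 or further.
\<close>

lemma degree_from_second:
  assumes "c \<in> second v"
  shows "card (E `` {c} \<inter> second v) + card (E `` {c} \<inter> remote v) = k - 1"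
proof -
  from assms obtain b where b: "(v, b) \<in> E" "(b, c) \<in> E" "c \<noteq> v"
    by (auto simp: second_def)
  have "E `` {c} - {b} = (E `` {c} \<inter> second v) \<union> (E `` {c} \<inter> remote v)"
  proof (intro equalityI subsetI)
    fix d assume d: "d \<in> E `` {c} - {b}"
    then have "d \<noteq> v" using triangle_free b by blast
    moreover have "(v, d) \<notin> E"
      using unique_common_neighbour[of v b c d] b d symD' by blast
    moreover have "d \<in> V" using d E_subset by auto
    ultimately show "d \<in> (E `` {c} \<inter> second v) \<union> (E `` {c} \<inter> remote v)"
      using d by (auto simp: remote_def)
  next
    fix d assume "d \<in> (E `` {c} \<inter> second v) \<union> (E `` {c} \<inter> remote v)"
    then show "d \<in> E `` {c} - {b}"
      using b(1) levels_disjoint[of v] by (auto simp: remote_def)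
  qed
  moreover have "card (E `` {c} - {b}) = k - 1"
    using b symD' degree[of c] E_subset by (auto simp: card_Diff_singleton)
  moreover have "(E `` {c} \<inter> second v) \<inter> (E `` {c} \<inter> remote v) = {}"
    by (auto simp: remote_def)
  ultimately show ?thesis
    by (metis card_Un_disjoint finite_Int finite_neighbours)
qed

text \<open>
  If only one vertex lies outside the ball of radius 2, it has nowhere to send its edges but to
  \<^term>\<open>second v\<close>. This is why the count below is determined for excess at most 1.
\<close>

lemma neighbours_of_remote:
  assumes "v \<in> V" and "card (remote v) \<le> 1" and "r \<in> remote v"
  shows "card (E `` {r} \<inter> second v) = k"
proof -
  have "remote v = {r}"
    using assms(2,3) finite_V card_le_Suc0_iff_eq[of "remote v"] by (auto simp: remote_def)
  moreover have "d \<in> second v \<union> remote v" if "d \<in> E `` {r}" for d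
    using assms(3) that symD' E_subset by (auto simp: remote_def second_def)
  ultimately have "E `` {r} \<inter> second v = E `` {r}"
    using loop_free by fastforce
  then show ?thesis
    using assms(3) degree by (simp add: remote_def)
qed

lemma card_arcs_in_second:
  assumes "v \<in> V" and "card (remote v) \<le> 1"
  shows "(\<Sum>c\<in>second v. card (E `` {c} \<inter> second v)) + k * card (remote v)
    = k * (k - 1) * (k - 1)"
proof -
  have fin: "finite (remote v)"
    using finite_V by (simp add: remote_def)
  \<comment> \<open>Count the edges between the two levels from either side.\<close>
  have card_eq: "card (E `` {x} \<inter> B) = (\<Sum>y\<in>B. if (x, y) \<in> E then 1 else 0)" if "finite B" for x B
    using that by (simp add: sum.If_cases Int_def conj_commute)
  have "(\<Sum>c\<in>second v. card (E `` {c} \<inter> remote v))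
      = (\<Sum>c\<in>second v. \<Sum>r\<in>remote v. if (c, r) \<in> E then 1 else 0)"
    by (simp add: card_eq fin)
  also have "\<dots> = (\<Sum>r\<in>remote v. \<Sum>c\<in>second v. if (c, r) \<in> E then 1 else 0)"
    by (rule sum.swap)
  also have "\<dots> = (\<Sum>r\<in>remote v. card (E `` {r} \<inter> second v))"
    unfolding card_eq[OF finite_second]
    using symD' by (intro sum.cong refl) (meson symD')
  also have "\<dots> = (\<Sum>r\<in>remote v. k)"
    by (rule sum.cong[OF refl neighbours_of_remote[OF assms]])
  finally have "(\<Sum>c\<in>second v. card (E `` {c} \<inter> remote v)) = k * card (remote v)"
    by simp
  moreover have "(\<Sum>c\<in>second v. card (E `` {c} \<inter> second v) + card (E `` {c} \<inter> remote v))
      = k * (k - 1) * (k - 1)"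
    using assms(1) by (simp add: degree_from_second card_second)
  ultimately show ?thesis
    by (simp add: sum.distrib)
qed

text \<open>
  A closed walk \<open>a, b, c, d, e\<close> is given by \<open>a\<close> and the arc \<open>(c, d)\<close> opposite to it, which joins
  two vertices at distance 2 from \<open>a\<close>: the connecting vertices \<open>b\<close> and \<open>e\<close> are unique as there are
  no 4-cycles.
\<close>

lemma card_closed_5walks:
  "card (closed_5walks E) = (\<Sum>v\<in>V. \<Sum>c\<in>second v. card (E `` {c} \<inter> second v))"
proof -
  define W where "W = (SIGMA v:V. SIGMA c:second v. E `` {c} \<inter> second v)"
  define f where "f = (\<lambda>(a::'a, b::'a, c::'a, d::'a, e::'a). (a, c, d))"
  have "bij_betw f (closed_5walks E) W"
  proof (rule bij_betw_imageI)
    show "inj_on f (closed_5walks E)"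
    proof (rule inj_onI)
      fix s t assume "s \<in> closed_5walks E" "t \<in> closed_5walks E" "f s = f t"
      then obtain a b c d e b' e' where st: "s = (a, b, c, d, e)" "t = (a, b', c, d, e')"
        and s: "(a, b) \<in> E" "(b, c) \<in> E" "(c, d) \<in> E" "(d, e) \<in> E" "(e, a) \<in> E"
        and t: "(a, b') \<in> E" "(b', c) \<in> E" "(d, e') \<in> E" "(e', a) \<in> E"
        by (auto simp: f_def closed_5walks_def)
      have "c \<noteq> a" "d \<noteq> a"
        using s triangle_free by blast+
      then have "b = b'" "e = e'"
        using s t unique_common_neighbour[of a b c b'] unique_common_neighbour[of d e a e'] by auto
      then show "s = t" by (simp add: st)
    qed
    show "f ` closed_5walks E = W"
    proof (intro equalityI subsetI)
      fix x assume "x \<in> f ` closed_5walks E"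
      then obtain a b c d e where x: "x = (a, c, d)"
        and w: "(a, b) \<in> E" "(b, c) \<in> E" "(c, d) \<in> E" "(d, e) \<in> E" "(e, a) \<in> E"
        by (auto simp: f_def closed_5walks_def)
      then have "c \<noteq> a" "d \<noteq> a"
        using triangle_free by blast+
      then show "x \<in> W"
        using x w symD' E_subset by (auto simp: W_def second_def)
    next
      fix x assume "x \<in> W"
      then obtain a c d where x: "x = (a, c, d)" and "c \<in> second a" "d \<in> second a"
        and cd: "(c, d) \<in> E"
        by (auto simp: W_def)
      then obtain b e where "(a, b) \<in> E" "(b, c) \<in> E" "(a, e) \<in> E" "(e, d) \<in> E"
        by (auto simp: second_def)
      then have "(a, b, c, d, e) \<in> closed_5walks E"
        using symD' cd by (auto simp: closed_5walks_def)
      then show "x \<in> f ` closed_5walks E"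
        unfolding x by (force simp: f_def image_iff)
    qed
  qed
  then have "card (closed_5walks E) = card W"
    by (rule bij_betw_same_card)
  also have "\<dots> = (\<Sum>v\<in>V. \<Sum>c\<in>second v. card (E `` {c} \<inter> second v))"
    unfolding W_def using finite_V finite_second finite_neighbours by (simp add: card_SigmaI)
  finally show ?thesis .
qed

lemma card_closed_5walks_near_Moore:
  assumes "card V \<le> k * k + 2"
  shows "card (closed_5walks E) + card V * (k * (card V - (k * k + 1)))
    = card V * (k * (k - 1) * (k - 1))"
proof -
  have *: "(\<Sum>c\<in>second v. card (E `` {c} \<inter> second v)) + k * (card V - (k * k + 1))
      = k * (k - 1) * (k - 1)" if "v \<in> V" for v
    using card_arcs_in_second[OF that] card_levels[OF that] assms by simp
  have "(\<Sum>v\<in>V. (\<Sum>c\<in>second v. card (E `` {c} \<inter> second v)) + k * (card V - (k * k + 1)))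
      = card V * (k * (k - 1) * (k - 1))"
    using * by simp
  then show ?thesis
    by (simp only: sum.distrib card_closed_5walks sum_constant of_nat_id)
qed

end

text \<open>
  The Moore bound is 17. Graphs of order 17 and 18 would have \<open>17 \<cdot> 36 = 612\<close> and
  \<open>18 \<cdot> (36 - 4) = 576\<close> closed walks of length five, and neither number is a multiple of five.
\<close>

lemma order_4_regular:
  assumes "regular_girth_ge5 V E 4" and "V \<noteq> {}"
  shows "19 \<le> card V"
proof (rule ccontr)
  interpret regular_girth_ge5 V E 4 by fact
  assume "\<not> 19 \<le> card V"
  moreover have "17 \<le> card V"
    using \<open>V \<noteq> {}\<close> card_levels by fastforce
  ultimately have "card V = 17 \<or> card V = 18" by auto
  then have "card (closed_5walks E) = 612 \<or> card (closed_5walks E) = 576"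
    using card_closed_5walks_near_Moore by auto
  moreover have "finite E"
    using finite_V E_subset by (auto intro: finite_subset)
  then have "5 dvd card (closed_5walks E)"
    using loop_free by (rule five_dvd_closed_5walks)
  ultimately show False by auto
qed

section \<open>Girth, connectedness and the adjacency relation\<close>

lemma out_degree_with_proj: "out_degree (with_proj G) v = card (parcs G `` {v})"
proof -
  have "out_arcs (with_proj G) v = Pair v ` (parcs G `` {v})"
    by (auto simp: out_arcs_def)
  then show ?thesis
    by (simp add: out_degree_def card_image inj_on_def)
qed

lemma cycle_with_proj:
  "pre_digraph.cycle (with_proj G) p \<longleftrightarrow>
    (\<exists>u\<in>pverts G. set p \<subseteq> parcs G \<and> pcas u p u \<and> distinct (tl (pawalk_verts u p)) \<and> p \<noteq> [])"
  by (auto simp: pre_digraph.cycle_def pre_digraph.awalk_def cas_with_proj_eq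
      awalk_verts_with_proj_eq)

lemma girth_le:
  assumes "pre_digraph.cycle (with_proj G) p" "3 \<le> length p"
  shows "girth G \<le> enat (length p)"
  unfolding girth_def using assms by (intro INF_lower) simp

lemma no_short_cycle_if_girth:
  assumes "pair_graph G" and "5 \<le> girth G"
  shows "no_short_cycle (parcs G)"
proof -
  interpret pair_graph G by fact
  have long: "5 \<le> length p" if "pre_digraph.cycle (with_proj G) p" "3 \<le> length p" for p
    using order_trans[OF assms(2) girth_le[OF that]] by (simp flip: enat_numeral)
  have False if "(a, b) \<in> parcs G" "(b, c) \<in> parcs G" "(c, a) \<in> parcs G" for a b c
    using long[of "[(a, b), (b, c), (c, a)]"] that
    by (auto simp: cycle_with_proj dest: no_loops' in_arcsD1)
  moreover have "a = c \<or> b = d" if "(a, b) \<in> parcs G" "(b, c) \<in> parcs G"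
    "(c, d) \<in> parcs G" "(d, a) \<in> parcs G" for a b c d
    using long[of "[(a, b), (b, c), (c, d), (d, a)]"] that
    by (auto simp: cycle_with_proj dest: no_loops' in_arcsD1)
  ultimately show ?thesis
    unfolding no_short_cycle_def by blast
qed

lemma girth_eq_5:
  assumes no_short: "no_short_cycle (parcs G)"
    and arcs: "parcs G \<subseteq> pverts G \<times> pverts G"
    and walk: "(a, b) \<in> parcs G" "(b, c) \<in> parcs G" "(c, d) \<in> parcs G" "(d, e) \<in> parcs G"
      "(e, a) \<in> parcs G"
    and dist: "distinct [a, b, c, d, e]"
  shows "girth G = enat 5"
proof (rule antisym)
  have "pre_digraph.cycle (with_proj G) [(a, b), (b, c), (c, d), (d, e), (e, a)]"
    using walk arcs dist by (auto simp: cycle_with_proj)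
  from girth_le[OF this] show "girth G \<le> enat 5"
    by (simp add: numeral_eq_Suc)
next
  have triangle_free: "False" if "(u, v) \<in> parcs G" "(v, w) \<in> parcs G" "(w, u) \<in> parcs G" for u v w
    using no_short that unfolding no_short_cycle_def by blast
  have square_free: "u = w \<or> v = x" if "(u, v) \<in> parcs G" "(v, w) \<in> parcs G"
    "(w, x) \<in> parcs G" "(x, u) \<in> parcs G" for u v w x
    using no_short that unfolding no_short_cycle_def by blast
  have "5 \<le> length p" if p: "pre_digraph.cycle (with_proj G) p" "3 \<le> length p" for p
  proof (rule ccontr)
    assume "\<not> 5 \<le> length p"
    with p(2) consider "length p = 3" | "length p = 4" by linarith
    then show False
    proof cases
      case 1
      then obtain e1 e2 e3 where "p = [e1, e2, e3]"
        by (auto simp: length_Suc_conv numeral_eq_Suc)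
      then show False
        using p(1) triangle_free by (cases e1; cases e2; cases e3) (auto simp: cycle_with_proj)
    next
      case 2
      then obtain e1 e2 e3 e4 where "p = [e1, e2, e3, e4]"
        by (auto simp: length_Suc_conv numeral_eq_Suc)
      with p(1) obtain u v w x where "(u, v) \<in> parcs G" "(v, w) \<in> parcs G"
        "(w, x) \<in> parcs G" "(x, u) \<in> parcs G" "u \<noteq> w" "v \<noteq> x"
        by (cases e1; cases e2; cases e3; cases e4) (simp add: cycle_with_proj, blast)
      then show False
        using square_free by blast
    qed
  qed
  then show "enat 5 \<le> girth G"
    unfolding girth_def by (intro INF_greatest) simp
qed

lemma connected_if_Hamiltonian_path:
  fixes G :: "nat pair_pre_digraph"
  assumes "pverts G = {..<n}" and "0 < n" and path: "\<And>i. Suc i < n \<Longrightarrow> (i, Suc i) \<in> parcs G"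
  shows "connected (with_proj G)"
proof -
  let ?R = "rtrancl_on {..<n} ((parcs G)\<^sup>s)"
  have from0: "(0, v) \<in> ?R" if "v < n" for v
    using that
  proof (induction v)
    case 0
    then show ?case by simp
  next
    case (Suc v)
    then have "(0, v) \<in> ?R" by simp
    moreover have "(v, Suc v) \<in> (parcs G)\<^sup>s"
      using path[OF Suc.prems] by (simp add: symcl_def)
    ultimately show ?case
      by (rule rtrancl_on_into_rtrancl_on) (simp add: Suc.prems)
  qed
  have sym: "sym ?R"
    by (rule rtrancl_on_sym) (auto simp: symcl_def sym_def)
  have "(u, v) \<in> ?R" if "u < n" "v < n" for u v
    using symD[OF sym from0[OF that(1)]] from0[OF that(2)] by (rule rtrancl_on_trans)
  then show ?thesis
    using assms by (auto simp: connected_conv)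
qed

section \<open>Welding Hamiltonian graphs\<close>

text \<open>
  The edges asked for are a Hamiltonian cycle \<open>0, 1, \<dots>, n - 1\<close> and the chord \<open>{0, 4}\<close>. The former
  gives connectedness, the latter the 5-cycle \<open>0, 1, 2, 3, 4\<close>. Deleting the closing edge
  \<open>{n - 1, 0}\<close> of the Hamiltonian cycle spoils neither of the two; this makes room for welding.
\<close>

definition weldable :: "nat \<Rightarrow> nat rel \<Rightarrow> bool" where
  "weldable n E \<longleftrightarrow> 6 \<le> n \<and> regular_girth_ge5 {..<n} E 4 \<and>
    (\<forall>i. Suc i < n \<longrightarrow> (i, Suc i) \<in> E) \<and> (0, n - 1) \<in> E \<and> (0, 4) \<in> E"

lemma weldable_in_spectrum:
  assumes "weldable n E"
  shows "n \<in> spectrum 4 5"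
proof -
  define G where "G = \<lparr>pverts = {..<n}, parcs = E\<rparr>"
  have n: "6 \<le> n" and path: "\<And>i. Suc i < n \<Longrightarrow> (i, Suc i) \<in> E" and chord: "(0, 4) \<in> E"
    using assms by (auto simp: weldable_def)
  interpret regular_girth_ge5 "{..<n}" E 4
    using assms by (simp add: weldable_def)
  have loop_free: "(v, v) \<notin> E" for v
    using no_short unfolding no_short_cycle_def by blast
  have "finite E"
    using E_subset by (rule finite_subset) simp
  have "pair_graph G"
    by unfold_locales
      (use E_subset \<open>finite E\<close> loop_free sym_E in \<open>auto simp: G_def symmetric_def\<close>)
  moreover have "regular 4 G"
    using degree by (simp add: regular_def out_degree_with_proj G_def)
  moreover have "girth G = enat 5"
  proof (rule girth_eq_5[of G 0 1 2 3 4])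
    show "no_short_cycle (parcs G)" "parcs G \<subseteq> pverts G \<times> pverts G"
      using no_short E_subset by (simp_all add: G_def)
    show "(0, 1) \<in> parcs G" "(1, 2) \<in> parcs G" "(2, 3) \<in> parcs G" "(3, 4) \<in> parcs G"
      using path[of 0] path[of 1] path[of 2] path[of 3] n
      by (simp_all add: G_def numeral_2_eq_2 numeral_3_eq_3 eval_nat_numeral)
    show "(4, 0) \<in> parcs G"
      using chord sym_E by (auto simp: G_def dest: symD)
  qed simp
  moreover have "connected (with_proj G)"
    by (rule connected_if_Hamiltonian_path[of _ n]) (use n path in \<open>auto simp: G_def\<close>)
  ultimately have "kg_graph 4 5 G \<and> connected (with_proj G) \<and> card (pverts G) = n"
    by (simp add: kg_graph_def G_def)
  then show ?thesis
    unfolding spectrum_def by blast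
qed

lemma order_4_5_graph:
  fixes G :: "'a pair_pre_digraph"
  assumes "kg_graph 4 5 G"
  shows "19 \<le> card (pverts G)"
proof (rule order_4_regular)
  interpret pair_graph G
    using assms by (simp add: kg_graph_def)
  have "no_short_cycle (parcs G)"
    using assms by (intro no_short_cycle_if_girth) (auto simp: kg_graph_def numeral_eq_enat)
  then show "regular_girth_ge5 (pverts G) (parcs G) 4"
    using assms pair_finite_verts arcs_symmetric in_arcsD1 in_arcsD2
    by unfold_locales
      (auto simp: kg_graph_def regular_def out_degree_with_proj intro: symI)
  show "pverts G \<noteq> {}"
  proof
    assume "pverts G = {}"
    then have "girth G = \<infinity>"
      by (auto simp: girth_def cycle_with_proj top_enat_def)
    then show False
      using assms by (simp add: kg_graph_def)
  qed
qed

text \<open>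
  The second graph is shifted by \<open>m\<close>, the closing edges of both Hamiltonian cycles are deleted, and
  their four ends are joined crosswise, so that the two Hamiltonian paths become one Hamiltonian
  cycle \<open>0, \<dots>, m - 1, m, \<dots>, m + n - 1\<close>.
\<close>

definition weld :: "nat \<Rightarrow> nat rel \<Rightarrow> nat \<Rightarrow> nat rel \<Rightarrow> nat rel" where
  "weld m E n F = {(u, v).
    (u, v) \<in> E \<and> (u, v) \<noteq> (0, m - 1) \<and> (u, v) \<noteq> (m - 1, 0) \<or>
    (\<exists>x y. u = m + x \<and> v = m + y \<and> (x, y) \<in> F \<and> (x, y) \<noteq> (0, n - 1) \<and> (x, y) \<noteq> (n - 1, 0)) \<or>
    (u, v) \<in> {(m - 1, m), (m, m - 1), (0, m + n - 1), (m + n - 1, 0)}}"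

lemma sym_weld:
  assumes "sym E" and "sym F"
  shows "sym (weld m E n F)"
proof (rule symI)
  fix u v assume "(u, v) \<in> weld m E n F"
  then consider "(u, v) \<in> E" "(u, v) \<noteq> (0, m - 1)" "(u, v) \<noteq> (m - 1, 0)"
    | x y where "u = m + x" "v = m + y" "(x, y) \<in> F" "(x, y) \<noteq> (0, n - 1)" "(x, y) \<noteq> (n - 1, 0)"
    | "(u, v) \<in> {(m - 1, m), (m, m - 1), (0, m + n - 1), (m + n - 1, 0)}"
    unfolding weld_def by blast
  then show "(v, u) \<in> weld m E n F"
    by cases (auto simp: weld_def symD[OF assms(1)] symD[OF assms(2)])
qed

lemma card_exchange:
  assumes "finite A" "a \<in> A" "b \<notin> A"
  shows "card (insert b (A - {a})) = card A"
  using assms by (metis card.remove card_insert_disjoint finite_Diff Diff_iff)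

text \<open>
  Each end of a deleted edge loses one neighbour and gains another, so degrees are kept. The two new
  edges form a matching between the parts. A cycle of length at most 4 that is not contained in one
  part would use both, and run within each part between the two ends of the deleted edge; having at
  most two further edges, it would traverse a deleted edge.
\<close>

lemma weldable_weld:
  assumes E: "weldable m E" and F: "weldable n F"
  shows "weldable (m + n) (weld m E n F)"
proof -
  interpret E: regular_girth_ge5 "{..<m}" E 4 using E by (simp add: weldable_def)
  interpret F: regular_girth_ge5 "{..<n}" F 4 using F by (simp add: weldable_def)
  let ?W = "weld m E n F"
  have m: "6 \<le> m" "(0, m - 1) \<in> E" "(0, 4) \<in> E" "\<And>i. Suc i < m \<Longrightarrow> (i, Suc i) \<in> E"
    using E by (auto simp: weldable_def)
  have n: "6 \<le> n" "(0, n - 1) \<in> F" "(0, 4) \<in> F" "\<And>i. Suc i < n \<Longrightarrow> (i, Suc i) \<in> F"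
    using F by (auto simp: weldable_def)
  have E_lt: "u < m" "v < m" if "(u, v) \<in> E" for u v
    using that E.E_subset by auto
  have F_lt: "u < n" "v < n" if "(u, v) \<in> F" for u v
    using that F.E_subset by auto
  have symW: "sym ?W"
    using E.sym_E F.sym_E by (rule sym_weld)
  have low: "(u, v) \<in> ?W \<longleftrightarrow> (u, v) \<in> E \<and> \<not> (u = 0 \<and> v = m - 1 \<or> u = m - 1 \<and> v = 0)"
    if "u < m" "v < m" for u v
    using that n(1) unfolding weld_def by auto
  have high: "(m + u, m + v) \<in> ?W \<longleftrightarrow> (u, v) \<in> F \<and> \<not> (u = 0 \<and> v = n - 1 \<or> u = n - 1 \<and> v = 0)"
    for u v
    using m(1) unfolding weld_def by (auto dest: E_lt)
  have cross: "(u, m + v) \<in> ?W \<longleftrightarrow> u = m - 1 \<and> v = 0 \<or> u = 0 \<and> v = n - 1"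
    if "u < m" for u v
    using that m(1) n(1) unfolding weld_def by (auto dest: E_lt)
  have cross': "(m + v, u) \<in> ?W \<longleftrightarrow> u = m - 1 \<and> v = 0 \<or> u = 0 \<and> v = n - 1"
    if "u < m" for u v
    using cross[OF that, of v] symW by (blast dest: symD)
  have side: "u < m \<or> (\<exists>u'. u = m + u')" for u
    by (meson leI le_iff_add)
  have W_lt: "u < m + n" if "(u, v) \<in> ?W" for u v
    using that m(1) n(1) unfolding weld_def by (auto dest: E_lt F_lt)
  have "?W \<subseteq> {..<m + n} \<times> {..<m + n}"
    using W_lt symW by (auto dest: symD)
  moreover have "no_short_cycle ?W"
  proof -
    \<comment> \<open>All distributions of the vertices to the two parts are checked; the subtractions undo the
      shift when every vertex lies in the second part.\<close>
    have "False" if "(a, b) \<in> ?W" "(b, c) \<in> ?W" "(c, a) \<in> ?W" for a b c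
      using side[of a] side[of b] side[of c] that m(1) n(1)
        E.triangle_free[of a b c] F.triangle_free[of "a - m" "b - m" "c - m"]
      by (elim disjE exE) (auto simp: low high cross cross' E.loop_free F.loop_free)
    moreover have "a = c \<or> b = d"
      if "(a, b) \<in> ?W" "(b, c) \<in> ?W" "(c, d) \<in> ?W" "(d, a) \<in> ?W" for a b c d
      using side[of a] side[of b] side[of c] side[of d] that m(1) n(1)
        E.square_free[of a b c d] F.square_free[of "a - m" "b - m" "c - m" "d - m"]
      by (elim disjE exE) (auto simp: low high cross cross' E.loop_free F.loop_free)
    ultimately show ?thesis
      unfolding no_short_cycle_def by blast
  qed
  moreover have "card (?W `` {v}) = 4" if v: "v < m + n" for v
  proof -
    have ends: "m - 1 \<in> E `` {0}" "0 \<in> E `` {m - 1}" "n - 1 \<in> F `` {0}" "0 \<in> F `` {n - 1}"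
      using m(2) n(2) E.symD' F.symD' by auto
    have new: "m + n - 1 \<notin> E `` {0}" "m \<notin> E `` {m - 1}"
      using n(1) by (auto dest: E_lt)
    have new': "m - 1 \<notin> (+) m ` F `` {0}" "0 \<notin> (+) m ` F `` {n - 1}"
      using m(1) by auto
    consider "v = 0" | "v = m - 1" | "v < m" "v \<noteq> 0" "v \<noteq> m - 1"
      | "v = m" | "v = m + (n - 1)" | u where "v = m + u" "u < n" "u \<noteq> 0" "u \<noteq> n - 1"
    proof (cases "v < m")
      case True
      then show thesis using that(1,2,3) by blast
    next
      case False
      then have "v = m + (v - m)" "v - m < n"
        using v by simp_all
      then show thesis using that(4,5,6) by (metis add_0_right)
    qed
    then show ?thesis
    proof cases
      case 1
      have "?W `` {0} = insert (m + n - 1) (E `` {0} - {m - 1})"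
      proof (rule set_eqI)
        fix w show "w \<in> ?W `` {0} \<longleftrightarrow> w \<in> insert (m + n - 1) (E `` {0} - {m - 1})"
          using side[of w] m(1) n(1) by (elim disjE exE) (auto simp: low cross dest: E_lt)
      qed
      then show ?thesis
        using card_exchange[OF E.finite_neighbours ends(1) new(1)] E.degree[of 0] m(1) 1 by simp
    next
      case 2
      have "?W `` {m - 1} = insert m (E `` {m - 1} - {0})"
      proof (rule set_eqI)
        fix w show "w \<in> ?W `` {m - 1} \<longleftrightarrow> w \<in> insert m (E `` {m - 1} - {0})"
          using side[of w] m(1) n(1) by (elim disjE exE) (auto simp: low cross dest: E_lt)
      qed
      then show ?thesis
        using card_exchange[OF E.finite_neighbours ends(2) new(2)] E.degree[of "m - 1"] m(1) 2 by simp
    next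
      case 3
      have "?W `` {v} = E `` {v}"
      proof (rule set_eqI)
        fix w show "w \<in> ?W `` {v} \<longleftrightarrow> w \<in> E `` {v}"
          using side[of w] 3 by (elim disjE exE) (auto simp: low cross dest: E_lt)
      qed
      then show ?thesis
        using E.degree[of v] 3 by simp
    next
      case 4
      have inner: "(m, m + y) \<in> ?W \<longleftrightarrow> (0, y) \<in> F \<and> y \<noteq> n - 1" for y
        using high[of 0 y] n(1) by simp
      have outer: "(m, w) \<in> ?W \<longleftrightarrow> w = m - 1" if "w < m" for w
        using cross'[OF that, of 0] n(1) by simp
      have "?W `` {m} = insert (m - 1) ((+) m ` F `` {0} - {m + (n - 1)})"
      proof (rule set_eqI)
        fix w show "w \<in> ?W `` {m} \<longleftrightarrow> w \<in> insert (m - 1) ((+) m ` F `` {0} - {m + (n - 1)})"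
          using side[of w] m(1) by (elim disjE exE) (auto simp: inner outer)
      qed
      moreover have "card (insert (m - 1) ((+) m ` F `` {0} - {m + (n - 1)})) = card ((+) m ` F `` {0})"
        using new'(1) ends(3) F.finite_neighbours by (intro card_exchange) auto
      moreover have "card ((+) m ` F `` {0}) = 4"
        using F.degree[of 0] n(1) by (simp add: card_image)
      ultimately show ?thesis
        using 4 by (simp only:)
    next
      case 5
      have inner: "(m + (n - 1), m + y) \<in> ?W \<longleftrightarrow> (n - 1, y) \<in> F \<and> y \<noteq> 0" for y
        using high[of "n - 1" y] n(1) by simp
      have outer: "(m + (n - 1), w) \<in> ?W \<longleftrightarrow> w = 0" if "w < m" for w
        using cross'[OF that, of "n - 1"] n(1) by simp
      have "?W `` {m + (n - 1)} = insert 0 ((+) m ` F `` {n - 1} - {m})"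
      proof (rule set_eqI)
        fix w show "w \<in> ?W `` {m + (n - 1)} \<longleftrightarrow> w \<in> insert 0 ((+) m ` F `` {n - 1} - {m})"
          using side[of w] m(1) by (elim disjE exE) (auto simp: inner[unfolded One_nat_def] outer[unfolded One_nat_def])
      qed
      moreover have "card (insert 0 ((+) m ` F `` {n - 1} - {m})) = card ((+) m ` F `` {n - 1})"
        using new'(2) ends(4) F.finite_neighbours by (intro card_exchange) force+
      moreover have "card ((+) m ` F `` {n - 1}) = 4"
        using F.degree[of "n - 1"] n(1) by (simp add: card_image)
      ultimately show ?thesis
        using 5 by (simp only:)
    next
      case 6
      have "?W `` {v} = (+) m ` F `` {u}"
      proof (rule set_eqI)
        fix w show "w \<in> ?W `` {v} \<longleftrightarrow> w \<in> (+) m ` F `` {u}"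
          using side[of w] 6 m(1) by (elim disjE exE) (auto simp: high cross')
      qed
      then show ?thesis
        using F.degree[of u] 6 by (simp add: card_image)
    qed
  qed
  ultimately have "regular_girth_ge5 {..<m + n} ?W 4"
    using symW by (simp add: regular_girth_ge5_def)
  moreover have "(i, Suc i) \<in> ?W" if i: "Suc i < m + n" for i
  proof -
    consider "Suc i < m" | "Suc i = m" | "m \<le> i"
      by linarith
    then show ?thesis
    proof cases
      case 1
      then show ?thesis
        using low[of i "Suc i"] m(1) m(4)[of i] by auto
    next
      case 2
      then show ?thesis
        using cross[of i 0] by auto
    next
      case 3
      define j where "j = i - m"
      have j: "i = m + j" "Suc j < n"
        using 3 i by (simp_all add: j_def)
      then show ?thesis
        using high[of j "Suc j"] n(1) n(4)[of j] by auto
    qed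
  qed
  moreover have "(0, m + n - 1) \<in> ?W"
    using cross[of 0 "n - 1"] m(1) n(1) by simp
  moreover have "(0, 4) \<in> ?W"
    using low[of 0 4] m(1,3) by simp
  ultimately show ?thesis
    using m(1) by (simp add: weldable_def)
qed

section \<open>Weldable graphs of small order\<close>

definition cyclic_arcs :: "'a list \<Rightarrow> ('a \<times> 'a) list" where
  "cyclic_arcs p = (let q = zip p (rotate1 p) in q @ map prod.swap q)"

definition out_neighbours :: "('a \<times> 'a) list \<Rightarrow> 'a \<Rightarrow> 'a list" where
  "out_neighbours as v = map snd (filter (\<lambda>e. fst e = v) as)"

text \<open>
  The list of \<open>v\<close>, its neighbours and their further neighbours enumerates the walks without
  backtracking of length at most 2 from \<open>v\<close>. A repetition is a cycle of length at most 4 through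
  \<open>v\<close>. The table of neighbours is an argument, so that evaluation computes it once.
\<close>

definition girth5_table :: "nat list list \<Rightarrow> bool" where
  "girth5_table T \<longleftrightarrow> list_all
    (\<lambda>(v, N). length N = 4 \<and> distinct (v # N @ concat (map (\<lambda>w. removeAll v (T ! w)) N)))
    (zip [0..<length T] T)"

definition two_cycles :: "nat list \<Rightarrow> (nat \<times> nat) list" where
  "two_cycles p = cyclic_arcs [0..<length p] @ cyclic_arcs p"

text \<open>
  That \<open>p\<close> begins with \<open>0, 4\<close> puts the chord \<open>{0, 4}\<close> into the graph. The table
  lists four neighbours of each vertex, hence each vertex occurs in \<open>p\<close> exactly once.
\<close>

definition weldable_code :: "nat \<Rightarrow> nat list \<Rightarrow> bool" where
  "weldable_code n p \<longleftrightarrow> length p = n \<and> 6 \<le> n \<and> list_all (\<lambda>v. v < n) p \<and> take 2 p = [0, 4] \<and>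
    girth5_table (map (out_neighbours (two_cycles p)) [0..<n])"

lemma set_out_neighbours: "set (out_neighbours as v) = set as `` {v}"
  by (force simp: out_neighbours_def)

lemma sym_cyclic_arcs: "sym (set (cyclic_arcs p))"
  by (auto simp: cyclic_arcs_def Let_def sym_def)

lemma cyclic_arcs_subset: "set (cyclic_arcs p) \<subseteq> set p \<times> set p"
  by (auto simp: cyclic_arcs_def Let_def dest: set_zip_leftD set_zip_rightD)

lemma in_cyclic_arcs:
  assumes "i < length p"
  shows "(p ! i, p ! (Suc i mod length p)) \<in> set (cyclic_arcs p)"
    and "(p ! (Suc i mod length p), p ! i) \<in> set (cyclic_arcs p)"
proof -
  have "(p ! i, p ! (Suc i mod length p)) \<in> set (zip p (rotate1 p))"
    using assms by (auto simp: in_set_zip nth_rotate1)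
  then show "(p ! i, p ! (Suc i mod length p)) \<in> set (cyclic_arcs p)"
    and "(p ! (Suc i mod length p), p ! i) \<in> set (cyclic_arcs p)"
    by (force simp: cyclic_arcs_def Let_def)+
qed

lemma distinct_concat_map_disjoint:
  assumes "distinct (concat (map f xs))" "x \<in> set xs" "y \<in> set xs" "x \<noteq> y"
  shows "set (f x) \<inter> set (f y) = {}"
  using assms by (induction xs) auto

lemma weldable_if_code:
  assumes "weldable_code n p"
  shows "\<exists>E. weldable n E"
proof
  define E where "E = set (two_cycles p)"
  define N where "N = out_neighbours (two_cycles p)"
  have len: "length p = n" "6 \<le> n" and p: "set p \<subseteq> {..<n}" "take 2 p = [0, 4]"
    using assms by (auto simp: weldable_code_def list_all_iff)
  have E_subset: "E \<subseteq> {..<n} \<times> {..<n}"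
    using p(1) len cyclic_arcs_subset[of p] cyclic_arcs_subset[of "[0..<n]"]
    by (fastforce simp: E_def two_cycles_def)
  have "sym E"
    using sym_Un[OF sym_cyclic_arcs sym_cyclic_arcs] by (simp add: E_def two_cycles_def)
  have set_N: "set (N v) = E `` {v}" for v
    by (simp add: N_def E_def set_out_neighbours)
  have table: "length (N v) = 4" 
    "distinct (v # N v @ concat (map (\<lambda>w. removeAll v (map N [0..<n] ! w)) (N v)))" if "v < n" for v
  proof -
    have "(v, N v) \<in> set (zip [0..<n] (map N [0..<n]))"
      using that by (auto simp: in_set_zip intro!: exI[of _ v])
    moreover have "\<forall>(v, M)\<in>set (zip [0..<n] (map N [0..<n])). length M = 4 \<and>
      distinct (v # M @ concat (map (\<lambda>w. removeAll v (map N [0..<n] ! w)) M))"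
      using assms unfolding weldable_code_def girth5_table_def list_all_iff N_def by simp
    ultimately have "length (N v) = 4 \<and>
      distinct (v # N v @ concat (map (\<lambda>w. removeAll v (map N [0..<n] ! w)) (N v)))"
      by fast
    then show "length (N v) = 4"
      "distinct (v # N v @ concat (map (\<lambda>w. removeAll v (map N [0..<n] ! w)) (N v)))"
      by blast+
  qed
  have "map (\<lambda>w. removeAll v (map N [0..<n] ! w)) (N v) = map (\<lambda>w. removeAll v (N w)) (N v)" for v
    using E_subset set_N by (intro map_cong refl) auto
  with table(2) have dist: "distinct (v # N v @ concat (map (\<lambda>w. removeAll v (N w)) (N v)))" if "v < n" for v
    using that by simp
  have loop_free: "(v, v) \<notin> E" for v
    using dist[of v] E_subset set_N[of v] by auto
  have "False" if "(a, b) \<in> E" "(b, c) \<in> E" "(c, a) \<in> E" for a b c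
  proof -
    have "a < n" "(a, c) \<in> E" "c \<noteq> a"
      using that E_subset \<open>sym E\<close> loop_free by (auto dest: symD)
    then show False
      using that dist[of a] set_N by auto
  qed
  moreover have "a = c \<or> b = d" if "(a, b) \<in> E" "(b, c) \<in> E" "(c, d) \<in> E" "(d, a) \<in> E" for a b c d
  proof (rule ccontr)
    assume neq: "\<not> (a = c \<or> b = d)"
    have "a < n" "(a, d) \<in> E" "(d, c) \<in> E"
      using that E_subset \<open>sym E\<close> by (auto dest: symD)
    then have "b \<in> set (N a)" "d \<in> set (N a)"
      "c \<in> set (removeAll a (N b))" "c \<in> set (removeAll a (N d))"
      using that neq set_N by auto
    moreover have "distinct (concat (map (\<lambda>w. removeAll a (N w)) (N a)))"
      using dist[OF \<open>a < n\<close>] by simp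
    ultimately show False
      using distinct_concat_map_disjoint[of "\<lambda>w. removeAll a (N w)" "N a" b d] neq by blast
  qed
  ultimately have "no_short_cycle E"
    unfolding no_short_cycle_def by blast
  moreover have "card (E `` {v}) = 4" if "v < n" for v
    using table(1)[OF that] dist[OF that] distinct_card[of "N v"] by (simp add: set_N)
  ultimately have "regular_girth_ge5 {..<n} E 4"
    using E_subset \<open>sym E\<close> by (simp add: regular_girth_ge5_def)
  moreover have "(i, Suc i) \<in> E" if "Suc i < n" for i
    using in_cyclic_arcs(1)[of i "[0..<n]"] that len by (simp add: E_def two_cycles_def)
  moreover have "(0, n - 1) \<in> E"
    using in_cyclic_arcs(2)[of "n - 1" "[0..<n]"] len by (simp add: E_def two_cycles_def)
  moreover have "(0, 4) \<in> E"
  proof -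
    have "p ! 0 = 0" "p ! 1 = 4"
      using p(2) len nth_take[of 0 2 p] nth_take[of 1 2 p] by simp_all
    then show ?thesis
      using in_cyclic_arcs(1)[of 0 p] len by (simp add: E_def two_cycles_def)
  qed
  ultimately show "weldable n E"
    using len by (simp add: weldable_def)
qed

text \<open>
  Each list is a second Hamiltonian cycle for the graph of the given order, found by backtracking.
  Orders 19 to 37 are needed, as welding with the graph of order 19 advances by 19.
\<close>

lemma weldable_19: "\<exists>E. weldable 19 E"
  by (rule weldable_if_code[of _ "[0, 4, 8, 12, 1, 6, 10, 18, 13, 5, 16, 9, 2, 14, 7, 17, 3, 11, 15]"]) code_simp

lemma weldable_20: "\<exists>E. weldable 20 E"
  by (rule weldable_if_code[of _ "[0, 4, 8, 12, 1, 6, 10, 3, 16, 7, 19, 13, 5, 17, 9, 14, 2, 18, 11, 15]"]) code_simp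

lemma weldable_21: "\<exists>E. weldable 21 E"
  by (rule weldable_if_code[of _ "[0, 4, 8, 12, 1, 6, 10, 3, 13, 17, 7, 20, 14, 5, 18, 9, 15, 2, 19, 11, 16]"]) code_simp

lemma weldable_22: "\<exists>E. weldable 22 E"
  by (rule weldable_if_code[of _ "[0, 4, 8, 12, 1, 6, 10, 3, 13, 17, 5, 20, 2, 15, 7, 18, 11, 21, 16, 9, 19, 14]"]) code_simp

lemma weldable_23: "\<exists>E. weldable 23 E"
  by (rule weldable_if_code[of _ "[0, 4, 16, 11, 6, 14, 19, 1, 8, 17, 13, 2, 10, 21, 7, 3, 18, 22, 15, 9, 5, 20, 12]"]) code_simp

lemma weldable_24: "\<exists>E. weldable 24 E"
  by (rule weldable_if_code[of _ "[0, 4, 8, 12, 1, 6, 10, 3, 13, 17, 5, 20, 2, 16, 22, 7, 19, 15, 9, 23, 18, 11, 21, 14]"]) code_simp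

lemma weldable_25: "\<exists>E. weldable 25 E"
  by (rule weldable_if_code[of _ "[0, 4, 8, 12, 1, 6, 10, 3, 13, 17, 5, 20, 2, 15, 24, 18, 9, 22, 14, 19, 7, 23, 11, 16, 21]"]) code_simp

lemma weldable_26: "\<exists>E. weldable 26 E"
  by (rule weldable_if_code[of _ "[0, 4, 8, 12, 1, 6, 10, 3, 13, 17, 5, 20, 2, 15, 7, 23, 11, 19, 25, 14, 22, 18, 9, 24,
      16, 21]"]) code_simp

lemma weldable_27: "\<exists>E. weldable 27 E"
  by (rule weldable_if_code[of _ "[0, 4, 18, 24, 9, 13, 21, 3, 7, 11, 15, 23, 1, 10, 19, 6, 14, 2, 17, 26, 22, 5, 12, 25,
      20, 16, 8]"]) code_simp

lemma weldable_28: "\<exists>E. weldable 28 E"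
  by (rule weldable_if_code[of _ "[0, 4, 18, 9, 21, 5, 11, 26, 7, 2, 23, 17, 13, 1, 10, 24, 19, 6, 15, 25, 3, 20, 14, 27,
      22, 12, 8, 16]"]) code_simp

lemma weldable_29: "\<exists>E. weldable 29 E"
  by (rule weldable_if_code[of _ "[0, 4, 19, 9, 16, 5, 11, 27, 21, 2, 24, 8, 14, 1, 6, 23, 13, 18, 26, 15, 20, 12, 3, 7,
      28, 17, 22, 10, 25]"]) code_simp

lemma weldable_30: "\<exists>E. weldable 30 E"
  by (rule weldable_if_code[of _ "[0, 4, 19, 9, 25, 5, 11, 29, 20, 15, 23, 12, 18, 6, 14, 26, 2, 7, 16, 27, 10, 22, 17, 1,
      24, 28, 3, 21, 13, 8]"]) code_simp

lemma weldable_31: "\<exists>E. weldable 31 E"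
  by (rule weldable_if_code[of _ "[0, 4, 28, 23, 6, 1, 18, 9, 26, 12, 29, 19, 14, 5, 11, 22, 2, 15, 27, 21, 8, 13, 17, 3,
      7, 25, 30, 16, 10, 24, 20]"]) code_simp

lemma weldable_32: "\<exists>E. weldable 32 E"
  by (rule weldable_if_code[of _ "[0, 4, 27, 11, 30, 8, 1, 17, 29, 22, 6, 10, 16, 26, 2, 21, 31, 13, 18, 24, 3, 9, 20, 12,
      5, 25, 14, 28, 19, 7, 15, 23]"]) code_simp

lemma weldable_33: "\<exists>E. weldable 33 E"
  by (rule weldable_if_code[of _ "[0, 4, 28, 14, 23, 7, 17, 10, 24, 2, 13, 6, 26, 1, 18, 5, 15, 9, 29, 22, 12, 16, 32, 27,
      19, 3, 30, 11, 20, 8, 31, 25, 21]"]) code_simp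

lemma weldable_34: "\<exists>E. weldable 34 E"
  by (rule weldable_if_code[of _ "[0, 4, 28, 12, 7, 24, 1, 15, 19, 9, 3, 30, 6, 18, 13, 31, 23, 17, 26, 21, 8, 33, 16, 5,
      25, 11, 20, 2, 32, 27, 14, 22, 29, 10]"]) code_simp

lemma weldable_35: "\<exists>E. weldable 35 E"
  by (rule weldable_if_code[of _ "[0, 4, 18, 12, 34, 24, 3, 31, 16, 7, 11, 26, 21, 5, 10, 30, 23, 1, 32, 9, 20, 28, 15, 2,
      6, 33, 22, 17, 27, 8, 13, 29, 25, 19, 14]"]) code_simp

lemma weldable_36: "\<exists>E. weldable 36 E"
  by (rule weldable_if_code[of _ "[0, 4, 31, 21, 1, 25, 8, 14, 19, 24, 29, 3, 22, 12, 34, 15, 23, 32, 6, 16, 26, 20, 5, 28,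
      11, 17, 33, 27, 7, 35, 10, 30, 13, 2, 9, 18]"]) code_simp

lemma weldable_37: "\<exists>E. weldable 37 E"
  by (rule weldable_if_code[of _ "[0, 4, 31, 23, 1, 12, 8, 21, 36, 26, 11, 34, 14, 25, 9, 17, 29, 33, 20, 27, 2, 35, 6, 16,
      22, 13, 5, 18, 32, 15, 10, 19, 30, 7, 3, 24, 28]"]) code_simp

lemma weldable_base:
  assumes "19 \<le> n" "n \<le> 37"
  shows "\<exists>E. weldable n E"
proof -
  have "n \<in> set [19..<38]"
    unfolding set_upt using assms by simp
  also have "[19..<38] = [19, 20, 21, 22, 23, 24, 25, 26, 27, 28, 29, 30, 31, 32, 33, 34, 35, 36, 37]"
    by (simp add: upt_conv_Cons)
  finally show ?thesis
    using weldable_19 weldable_20 weldable_21 weldable_22 weldable_23 weldable_24 weldable_25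
      weldable_26 weldable_27 weldable_28 weldable_29 weldable_30 weldable_31
      weldable_32 weldable_33 weldable_34 weldable_35 weldable_36 weldable_37
    by auto
qed

lemma weldable_exists:
  assumes "19 \<le> n"
  shows "\<exists>E. weldable n E"
  using assms
proof (induction n rule: less_induct)
  case (less n)
  show ?case
  proof (cases "n \<le> 37")
    case True
    then show ?thesis using weldable_base less.prems by blast
  next
    case False
    then obtain E F where "weldable (n - 19) E" "weldable 19 F"
      using less.IH[of "n - 19"] weldable_base[of 19] by fastforce
    then have "weldable (n - 19 + 19) (weld (n - 19) E 19 F)"
      by (rule weldable_weld)
    then show ?thesis using False by auto
  qed
qed

theorem mainTheorem10:
  shows "spectrum 4 5 = {n. 19 \<le> n} \<and>
    spectrum_threshold 4 5 = min_order 4 5 \<and> min_order 4 5 = 19"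
proof -
  have "n \<in> spectrum 4 5" if "19 \<le> n" for n
    using weldable_exists[OF that] weldable_in_spectrum by blast
  moreover have "19 \<le> n" if "n \<in> spectrum 4 5" for n
    using that order_4_5_graph by (auto simp: spectrum_def)
  ultimately have spectrum: "spectrum 4 5 = {n. 19 \<le> n}"
    by blast
  have "spectrum_threshold 4 5 = 19"
    unfolding spectrum_threshold_def by (rule Least_equality) (auto simp: spectrum)
  moreover have "min_order 4 5 = 19"
    unfolding min_order_def
  proof (rule Least_equality)
    have "19 \<in> spectrum 4 5" by (simp add: spectrum)
    then show "\<exists>G :: nat pair_pre_digraph. kg_graph 4 5 G \<and> card (pverts G) = 19"
      by (auto simp: spectrum_def)
  qed (use order_4_5_graph in auto)
  ultimately show ?thesis
    using spectrum by simp
qed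

end
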